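(* Let $V$, $M$, $\mathcal Z$, $\hat\mu$, $S$, $\mathcal H'$, $\Pi_{kl}$ and $\widehat C_{kl}$ be as defined in the context. Suppose that: (1) (joint exchangeability) $(V^\sigma,M^\sigma)\stackrel{d}{=}(V,M)$ for every permutation $\sigma$ of $[n]$; (2) (network covariates) $\mathcal Z^\sigma=\zeta(\mathcal X^\sigma)$ for every permutation $\sigma$ of $[n]$; (3) (permutation-invariant model) $\boldsymbol{\hat\mu}^\sigma=(\hat\mu(\mathcal I_{ij}^\sigma;\mathcal T^\sigma))_{(i,j)\in[n]^2}$ for every permutation $\sigma$ of $[n]$; (4) $S=(S_{ij})_{1\le i,j\le n}$ is a symmetric array. Then for any $1\le k<l\le n$ and any $t\in[0,1]$, $$P\left(\Pi_{kl}\le t \mid M_{kl}=1\right)\le t .$$ Consequently, for any $\alpha\in[0,1]$, $$P\left(Y_{kl}\in\widehat C_{kl}\mid M_{kl}=1\right)\ge 1-\alpha .$$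
   Context: Let $[n]=\{1,\dots,n\}$. For an array $B=(B_{ij})_{i,j\in[n]}$ and a permutation $\sigma$ of $[n]$, $B^\sigma=(B_{\sigma(i),\sigma(j)})_{i,j\in[n]}$. Data: $V=(V_{ij})_{i,j\in[n]}$ with $V_{ij}=(Y_{ij},X_i,X_j,E_{ij})$, where $Y_{ij}$ is a real response, $X_i$ a node covariate, and $E_{ij}$ an edge covariate. $M=(M_{ij})_{i,j\in[n]}$ is a random binary matrix; $M_{ij}=1$ means that the pair $(i,j)$ is sampled. Network summary statistics: $\mathcal X=(\mathcal X_{ij})_{i,j\in[n]}$ with $\mathcal X_{ij}=(X_i,X_j,E_{ij},M_{ij})$, and $\mathcal Z=\zeta(\mathcal X)$ for a measurable function $\zeta$, where $\mathcal Z$ is an array with entries $(\mathcal Z_i,\mathcal Z_j,\mathcal Z_{ij})$, $i,j\in[n]$ (node-level and pair-level summaries); in what follows the subscript $ij$ on $\mathcal Z$ refers to the $(i,j)$ entry of this array. Model: let $\mathcal H=\{(i,j): M_{ij}=1\}$, $\mathcal H^\sigma=\{(i,j): M^\sigma_{ij}=1\}$, $$\mathcal T=(V_{ij},\mathcal Z_{ij})_{(i,j)\in\mathcal H},\quad \mathcal T^\sigma=(V^\sigma_{ij},\mathcal Z^\sigma_{ij})_{(i,j)\in\mathcal H^\sigma},$$ $$\mathcal I=(\mathcal X_{ij},\mathcal Z_{ij},M_{ij})_{(i,j)\in[n]^2},\quad \mathcal I^\sigma=(\mathcal X^\sigma_{ij},\mathcal Z^\sigma_{ij},M^\sigma_{ij})_{(i,j)\in[n]^2}.$$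 The fitted values are $\boldsymbol{\hat\mu}_{ij}=\hat\mu(\mathcal I_{ij};\mathcal T)$, the output for the pair $(i,j)$ of the model $\hat\mu$ trained on $\mathcal T$ (the output may be $\infty$ when $M_{ij}=0$), and $\boldsymbol{\hat\mu}=(\boldsymbol{\hat\mu}_{ij})_{1\le i,j\le n}$. Scores: for a nonconformity score $s:\mathbb R\times\mathbb R\to\mathbb R$, $S_{ij}=s(Y_{ij},\boldsymbol{\hat\mu}_{ij})$. Let $\mathcal H'=\{(i,j):1\le i<j\le n,\ M_{ij}=1\}$ and $$\Pi_{kl}=\frac1{|\mathcal H'|}\sum_{(i,j)\in\mathcal H'}\mathbf 1(S_{ij}\ge S_{kl}).$$ Full conformal prediction set: $\widehat C_{kl}=\{y_{kl}:\Pi_{kl}>\alpha\}$, where $\Pi_{kl}$ is regarded as a function of the candidate response value $y_{kl}$ for the test pair $\{k,l\}$: since $\hat\mu$ is fitted using the observation corresponding to $\{k,l\}$, the model is refitted and all scores are recomputed for each candidate value $y_{kl}$; at $y_{kl}=Y_{kl}$ this is the quantity $\Pi_{kl}$ displayed above.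
   Formalization: The sampling matrix M is additionally assumed symmetric almost surely (M_ij = M_ji); without this the claim fails, e.g. for n = 3 with M a randomly relabelled directed 3-cycle and scores 3, 2, 1. *)

theory Defs
  imports "HOL-Probability.Probability" "HOL-Combinatorics.Permutations"
begin

text \<open>
  Arrays indexed by [n] x [n] are functions on \<^typ>\<open>nat \<times> nat\<close>, extensional outside
  \<open>pairs n\<close>, so that they live in the product spaces \<^const>\<open>PiM\<close>.
  A binary entry equal to 1 is the Boolean \<^const>\<open>True\<close>.
\<close>

definition pairs :: "nat \<Rightarrow> (nat \<times> nat) set" where
  "pairs n = {1..n} \<times> {1..n}"

definition perm_array :: "nat \<Rightarrow> (nat \<Rightarrow> nat) \<Rightarrow> (nat \<times> nat \<Rightarrow> 'a) \<Rightarrow> nat \<times> nat \<Rightarrow> 'a" where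
  "perm_array n \<sigma> B = (\<lambda>(i, j)\<in>pairs n. B (\<sigma> i, \<sigma> j))"

definition arrays :: "nat \<Rightarrow> 'a measure \<Rightarrow> (nat \<times> nat \<Rightarrow> 'a) measure" where
  "arrays n K = PiM (pairs n) (\<lambda>_. K)"

type_synonym ('x, 'e) obs = "real \<times> 'x \<times> 'x \<times> 'e"
type_synonym ('x, 'e) netcov = "'x \<times> 'x \<times> 'e \<times> bool"
type_synonym ('u, 'w) netsum = "'u \<times> 'u \<times> 'w"
type_synonym ('x, 'e, 'u, 'w) info = "('x, 'e) netcov \<times> ('u, 'w) netsum \<times> bool"

text \<open>A family indexed by a subset H of [n] x [n] is the pair of H and an extensional function on H.\<close>

type_synonym ('x, 'e, 'u, 'w) training =
  "(nat \<times> nat) set \<times> (nat \<times> nat \<Rightarrow> ('x, 'e) obs \<times> ('u, 'w) netsum)"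

definition obs_space :: "'x measure \<Rightarrow> 'e measure \<Rightarrow> ('x, 'e) obs measure" where
  "obs_space MX ME = borel \<Otimes>\<^sub>M MX \<Otimes>\<^sub>M MX \<Otimes>\<^sub>M ME"

definition netcov_space :: "'x measure \<Rightarrow> 'e measure \<Rightarrow> ('x, 'e) netcov measure" where
  "netcov_space MX ME = MX \<Otimes>\<^sub>M MX \<Otimes>\<^sub>M ME \<Otimes>\<^sub>M count_space UNIV"

definition netsum_space :: "'u measure \<Rightarrow> 'w measure \<Rightarrow> ('u, 'w) netsum measure" where
  "netsum_space MU MW = MU \<Otimes>\<^sub>M MU \<Otimes>\<^sub>M MW"

definition info_space ::
  "'x measure \<Rightarrow> 'e measure \<Rightarrow> 'u measure \<Rightarrow> 'w measure \<Rightarrow> ('x, 'e, 'u, 'w) info measure" where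
  "info_space MX ME MU MW = netcov_space MX ME \<Otimes>\<^sub>M netsum_space MU MW \<Otimes>\<^sub>M count_space UNIV"

definition obs_array ::
  "nat \<Rightarrow> (nat \<times> nat \<Rightarrow> 'o \<Rightarrow> real) \<Rightarrow> (nat \<Rightarrow> 'o \<Rightarrow> 'x) \<Rightarrow> (nat \<times> nat \<Rightarrow> 'o \<Rightarrow> 'e)
    \<Rightarrow> 'o \<Rightarrow> nat \<times> nat \<Rightarrow> ('x, 'e) obs" where
  "obs_array n Y X E \<omega> = (\<lambda>(i, j)\<in>pairs n. (Y (i, j) \<omega>, X i \<omega>, X j \<omega>, E (i, j) \<omega>))"

definition sample_array :: "nat \<Rightarrow> (nat \<times> nat \<Rightarrow> 'o \<Rightarrow> bool) \<Rightarrow> 'o \<Rightarrow> nat \<times> nat \<Rightarrow> bool" where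
  "sample_array n M \<omega> = (\<lambda>p\<in>pairs n. M p \<omega>)"

text \<open>
  From here on everything is a deterministic function of a realised data array \<open>v\<close> and a realised
  sampling matrix \<open>m\<close>; this is what allows the model to be refitted for a candidate response.
\<close>

definition netcov_array ::
  "nat \<Rightarrow> (nat \<times> nat \<Rightarrow> ('x, 'e) obs) \<Rightarrow> (nat \<times> nat \<Rightarrow> bool) \<Rightarrow> nat \<times> nat \<Rightarrow> ('x, 'e) netcov" where
  "netcov_array n v m = (\<lambda>p\<in>pairs n. case v p of (_, x, x', e) \<Rightarrow> (x, x', e, m p))"

definition node_pair_array :: "nat \<Rightarrow> (nat \<times> nat \<Rightarrow> ('u, 'w) netsum) \<Rightarrow> bool" where
  "node_pair_array n z \<longleftrightarrow> (\<exists>a b. \<forall>i\<in>{1..n}. \<forall>j\<in>{1..n}. z (i, j) = (a i, a j, b (i, j)))"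

definition training_set ::
  "nat \<Rightarrow> (nat \<times> nat \<Rightarrow> ('x, 'e) obs) \<Rightarrow> (nat \<times> nat \<Rightarrow> ('u, 'w) netsum) \<Rightarrow> (nat \<times> nat \<Rightarrow> bool)
    \<Rightarrow> ('x, 'e, 'u, 'w) training" where
  "training_set n v z m =
     (let H = {p \<in> pairs n. m p} in (H, \<lambda>p\<in>H. (v p, z p)))"

definition info_array ::
  "nat \<Rightarrow> (nat \<times> nat \<Rightarrow> ('x, 'e) netcov) \<Rightarrow> (nat \<times> nat \<Rightarrow> ('u, 'w) netsum) \<Rightarrow> (nat \<times> nat \<Rightarrow> bool)
    \<Rightarrow> nat \<times> nat \<Rightarrow> ('x, 'e, 'u, 'w) info" where
  "info_array n x z m = (\<lambda>p\<in>pairs n. (x p, z p, m p))"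

definition predictions ::
  "nat \<Rightarrow> (('x, 'e, 'u, 'w) info \<Rightarrow> ('x, 'e, 'u, 'w) training \<Rightarrow> ereal)
    \<Rightarrow> (nat \<times> nat \<Rightarrow> ('x, 'e, 'u, 'w) info) \<Rightarrow> ('x, 'e, 'u, 'w) training \<Rightarrow> nat \<times> nat \<Rightarrow> ereal" where
  "predictions n mu I T = (\<lambda>p\<in>pairs n. mu (I p) T)"

definition fitted ::
  "nat \<Rightarrow> ((nat \<times> nat \<Rightarrow> ('x, 'e) netcov) \<Rightarrow> nat \<times> nat \<Rightarrow> ('u, 'w) netsum)
    \<Rightarrow> (('x, 'e, 'u, 'w) info \<Rightarrow> ('x, 'e, 'u, 'w) training \<Rightarrow> ereal)
    \<Rightarrow> (nat \<times> nat \<Rightarrow> ('x, 'e) obs) \<Rightarrow> (nat \<times> nat \<Rightarrow> bool) \<Rightarrow> nat \<times> nat \<Rightarrow> ereal" where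
  "fitted n \<zeta> mu v m =
     (let x = netcov_array n v m; z = \<zeta> x
      in predictions n mu (info_array n x z m) (training_set n v z m))"

text \<open>
  The score function takes real arguments. Where the model returns an infinite value
  (possible only for pairs that are not sampled) the score is infinite by convention.
\<close>

definition scores ::
  "nat \<Rightarrow> ((nat \<times> nat \<Rightarrow> ('x, 'e) netcov) \<Rightarrow> nat \<times> nat \<Rightarrow> ('u, 'w) netsum)
    \<Rightarrow> (('x, 'e, 'u, 'w) info \<Rightarrow> ('x, 'e, 'u, 'w) training \<Rightarrow> ereal) \<Rightarrow> (real \<Rightarrow> real \<Rightarrow> real)
    \<Rightarrow> (nat \<times> nat \<Rightarrow> ('x, 'e) obs) \<Rightarrow> (nat \<times> nat \<Rightarrow> bool) \<Rightarrow> nat \<times> nat \<Rightarrow> ereal" where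
  "scores n \<zeta> mu s v m =
     (\<lambda>p\<in>pairs n. let f = fitted n \<zeta> mu v m p
        in if \<bar>f\<bar> = \<infinity> then \<infinity> else ereal (s (fst (v p)) (real_of_ereal f)))"

definition upper_sampled :: "nat \<Rightarrow> (nat \<times> nat \<Rightarrow> bool) \<Rightarrow> (nat \<times> nat) set" where
  "upper_sampled n m = {(i, j). 1 \<le> i \<and> i < j \<and> j \<le> n \<and> m (i, j)}"

definition conf_pvalue ::
  "nat \<Rightarrow> ((nat \<times> nat \<Rightarrow> ('x, 'e) netcov) \<Rightarrow> nat \<times> nat \<Rightarrow> ('u, 'w) netsum)
    \<Rightarrow> (('x, 'e, 'u, 'w) info \<Rightarrow> ('x, 'e, 'u, 'w) training \<Rightarrow> ereal) \<Rightarrow> (real \<Rightarrow> real \<Rightarrow> real)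
    \<Rightarrow> (nat \<times> nat \<Rightarrow> ('x, 'e) obs) \<Rightarrow> (nat \<times> nat \<Rightarrow> bool) \<Rightarrow> nat \<times> nat \<Rightarrow> real" where
  "conf_pvalue n \<zeta> mu s v m q =
     (1 / real (card (upper_sampled n m))) *
     (\<Sum>p\<in>upper_sampled n m. of_bool (scores n \<zeta> mu s v m p \<ge> scores n \<zeta> mu s v m q))"

text \<open>
  The entries of the response array that record the response of the test pair. When the response
  array is symmetric, \<open>(k, l)\<close> and \<open>(l, k)\<close> carry the same response, so both must be overwritten by
  the candidate value. When they are different random variables, the \<open>(l, k)\<close> entry is a separate
  observation and is kept. In both cases the data are unchanged if the candidate is the true response.
\<close>

definition test_entries ::
  "'o measure \<Rightarrow> (nat \<times> nat \<Rightarrow> 'o \<Rightarrow> real) \<Rightarrow> nat \<Rightarrow> nat \<Rightarrow> (nat \<times> nat) set" where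
  "test_entries P Y k l = {p \<in> {(k, l), (l, k)}. \<forall>\<omega>\<in>space P. Y p \<omega> = Y (k, l) \<omega>}"

definition set_response ::
  "(nat \<times> nat) set \<Rightarrow> real \<Rightarrow> (nat \<times> nat \<Rightarrow> ('x, 'e) obs) \<Rightarrow> nat \<times> nat \<Rightarrow> ('x, 'e) obs" where
  "set_response R y v = (\<lambda>p. if p \<in> R then (y, snd (v p)) else v p)"

definition conf_set ::
  "nat \<Rightarrow> ((nat \<times> nat \<Rightarrow> ('x, 'e) netcov) \<Rightarrow> nat \<times> nat \<Rightarrow> ('u, 'w) netsum)
    \<Rightarrow> (('x, 'e, 'u, 'w) info \<Rightarrow> ('x, 'e, 'u, 'w) training \<Rightarrow> ereal) \<Rightarrow> (real \<Rightarrow> real \<Rightarrow> real)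
    \<Rightarrow> real \<Rightarrow> (nat \<times> nat) set \<Rightarrow> (nat \<times> nat \<Rightarrow> ('x, 'e) obs) \<Rightarrow> (nat \<times> nat \<Rightarrow> bool)
    \<Rightarrow> nat \<times> nat \<Rightarrow> real set" where
  "conf_set n \<zeta> mu s \<alpha> R v m q = {y. conf_pvalue n \<zeta> mu s (set_response R y v) m q > \<alpha>}"

end

theory Submission imports Defs begin

text \<open>
  Under the invariance assumptions the pair (scores, sampling matrix) is a jointly exchangeable
  array. By symmetry the p-value can be computed over all sampled off-diagonal entries, an index set
  that is permutation invariant, so the events \<open>\<Pi>\<^sub>p \<le> t \<and> M\<^sub>p\<close> have the same probability for all
  off-diagonal \<open>p\<close>. Deterministically, at most a fraction \<open>t\<close> of the sampled entries
  have p-value at most \<open>t\<close>; taking expectations gives \<open>P (\<Pi>\<^sub>p \<le> t \<and> M\<^sub>p) \<le> t P (M\<^sub>p)\<close>.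
\<close>

section \<open>Rank p-values of a fixed score array: counting and symmetry\<close>

definition rank_pvalue :: "(nat \<times> nat) set \<Rightarrow> (nat \<times> nat \<Rightarrow> ereal) \<Rightarrow> (nat \<times> nat \<Rightarrow> bool)
    \<Rightarrow> nat \<times> nat \<Rightarrow> real" where
  "rank_pvalue I S m q =
     (1 / real (card {p \<in> I. m p})) * real (card {p \<in> I. m p \<and> S p \<ge> S q})"

definition off_diag :: "nat \<Rightarrow> (nat \<times> nat) set" where
  "off_diag n = {(i, j) \<in> pairs n. i \<noteq> j}"

definition upper_pairs :: "nat \<Rightarrow> (nat \<times> nat) set" where
  "upper_pairs n = {(i, j) \<in> pairs n. i < j}"

lemma finite_pairs [simp]: "finite (pairs n)"
  by (simp add: pairs_def)

lemma off_diag_subset: "off_diag n \<subseteq> pairs n"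
  by (auto simp: off_diag_def)

lemma upper_pairs_subset: "upper_pairs n \<subseteq> pairs n"
  by (auto simp: upper_pairs_def)

lemma finite_off_diag [simp]: "finite (off_diag n)"
  using off_diag_subset finite_pairs by (rule finite_subset)

lemma finite_upper_pairs [simp]: "finite (upper_pairs n)"
  using upper_pairs_subset finite_pairs by (rule finite_subset)

text \<open>This separates ranking from model fitting: the p-value depends on the data only through
  the score array and the sampling matrix, and the index set becomes a parameter that can later be
  enlarged.\<close>

lemma conf_pvalue_eq_rank_pvalue:
  "conf_pvalue n \<zeta> mu s v m q = rank_pvalue (upper_pairs n) (scores n \<zeta> mu s v m) m q"
proof -
  have U: "upper_sampled n m = {p \<in> upper_pairs n. m p}"
    by (auto simp: upper_sampled_def upper_pairs_def pairs_def)
  have "finite (upper_sampled n m)"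
    unfolding U by simp
  then show ?thesis
    unfolding conf_pvalue_def rank_pvalue_def U by (simp add: of_bool_def sum.If_cases Int_def conj_assoc)
qed

text \<open>If no entry of \<open>I\<close> is sampled, division by zero makes the value 0, so the
  bound survives. At threshold 1 the p-value condition is then vacuous, which later recovers the
  event that an entry is sampled.\<close>

lemma rank_pvalue_le_1:
  assumes "finite I"
  shows "rank_pvalue I S m q \<le> 1"
proof -
  have "card {p \<in> I. m p \<and> S p \<ge> S q} \<le> card {p \<in> I. m p}"
    using assms by (intro card_mono) auto
  then show ?thesis by (auto simp: rank_pvalue_def divide_le_eq_1)
qed

text \<open>Among the sampled entries with p-value at most t, take \<open>q\<close> with the
  smallest score. All the others score at least as high, so each is counted in the numerator of the
  p-value of \<open>q\<close>, and that numerator is at most t times the number of sampled entries.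
  Ties do no harm, since they only enlarge the numerator.\<close>

lemma card_low_rank_pvalue_le:
  assumes fin: "finite I" and t: "0 \<le> t"
  shows "real (card {q \<in> I. m q \<and> rank_pvalue I S m q \<le> t}) \<le> t * real (card {p \<in> I. m p})"
proof (cases "{q \<in> I. m q \<and> rank_pvalue I S m q \<le> t} = {}")
  case True
  then show ?thesis using t by (metis card.empty of_nat_0 mult_nonneg_nonneg of_nat_0_le_iff)
next
  case False
  let ?B = "{q \<in> I. m q \<and> rank_pvalue I S m q \<le> t}"
  have finB: "finite ?B" using fin by simp
  obtain q where q: "q \<in> ?B" and q_min: "\<And>p. p \<in> ?B \<Longrightarrow> S q \<le> S p"
    using ex_min_if_finite[of "S ` ?B"] finB False by (auto simp: not_less)
  have "q \<in> {p \<in> I. m p}" using q by simp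
  then have "0 < card {p \<in> I. m p}" using fin unfolding card_gt_0_iff by (intro conjI) (fast, simp)
  then have "real (card {p \<in> I. m p \<and> S p \<ge> S q}) \<le> t * real (card {p \<in> I. m p})"
    using q by (simp add: rank_pvalue_def divide_le_eq)
  moreover have "card ?B \<le> card {p \<in> I. m p \<and> S p \<ge> S q}"
    using fin q_min by (intro card_mono) auto
  ultimately show ?thesis by linarith
qed

text \<open>The off-diagonal entries split into the upper triangle and its disjoint mirror image
  under \<open>prod.swap\<close>; a symmetric predicate selects equally many entries in both
  halves.\<close>

lemma card_off_diag_symmetric:
  assumes sym: "\<And>i j. (i, j) \<in> off_diag n \<Longrightarrow> Q (i, j) \<longleftrightarrow> Q (j, i)"
  shows "card {p \<in> off_diag n. Q p} = 2 * card {p \<in> upper_pairs n. Q p}"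
proof -
  let ?U = "{p \<in> upper_pairs n. Q p}"
  have "{p \<in> off_diag n. Q p} = ?U \<union> prod.swap ` ?U"
  proof (intro set_eqI iffI)
    fix p assume p: "p \<in> {p \<in> off_diag n. Q p}"
    obtain i j where ij: "p = (i, j)" by (cases p)
    show "p \<in> ?U \<union> prod.swap ` ?U"
    proof (cases "i < j")
      case True
      then show ?thesis using p ij by (auto simp: off_diag_def upper_pairs_def)
    next
      case False
      then have "(j, i) \<in> ?U"
        using p ij sym[of i j] by (auto simp: off_diag_def upper_pairs_def pairs_def)
      then show ?thesis unfolding ij by (auto intro: rev_image_eqI)
    qed
  next
    fix p assume "p \<in> ?U \<union> prod.swap ` ?U"
    then show "p \<in> {p \<in> off_diag n. Q p}"
      using sym by (auto simp: off_diag_def upper_pairs_def pairs_def)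
  qed
  moreover have "finite ?U" by simp
  moreover have "?U \<inter> prod.swap ` ?U = {}" by (auto simp: upper_pairs_def)
  moreover have "card (prod.swap ` ?U) = card ?U" by (intro card_image) (auto simp: inj_on_def)
  ultimately show ?thesis by (simp add: card_Un_disjoint)
qed

text \<open>Passing from the upper triangle to all off-diagonal entries doubles both the numerator
  and the denominator, and the factor 2 cancels.\<close>

lemma rank_pvalue_symmetric:
  assumes "\<And>i j. (i, j) \<in> off_diag n \<Longrightarrow> S (i, j) = S (j, i)"
    and "\<And>i j. (i, j) \<in> off_diag n \<Longrightarrow> m (i, j) \<longleftrightarrow> m (j, i)"
  shows "rank_pvalue (upper_pairs n) S m q = rank_pvalue (off_diag n) S m q"
proof -
  have "card {p \<in> off_diag n. m p} = 2 * card {p \<in> upper_pairs n. m p}"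
    using assms(2) by (rule card_off_diag_symmetric)
  moreover have "card {p \<in> off_diag n. m p \<and> S p \<ge> S q} = 2 * card {p \<in> upper_pairs n. m p \<and> S p \<ge> S q}"
    using assms by (intro card_off_diag_symmetric) metis
  ultimately show ?thesis by (simp add: rank_pvalue_def)
qed

section \<open>Simultaneous permutation of both coordinates\<close>

lemma card_off_diag_perm:
  assumes \<sigma>: "\<sigma> permutes {1..n}"
  shows "card {p \<in> off_diag n. Q (map_prod \<sigma> \<sigma> p)} = card {p \<in> off_diag n. Q p}"
proof (rule bij_betw_same_card)
  have mem: "\<sigma> i \<in> {1..n} \<longleftrightarrow> i \<in> {1..n}" for i using \<sigma> by (rule permutes_in_image)
  have inj: "\<sigma> i = \<sigma> j \<longleftrightarrow> i = j" for i j using permutes_inj[OF \<sigma>] by (auto dest: injD)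
  \<comment> \<open>Injectivity of \<sigma> keeps the two coordinates distinct, so the off-diagonal
    is invariant; the upper triangle would not be.\<close>
  have off: "map_prod \<sigma> \<sigma> p \<in> off_diag n \<longleftrightarrow> p \<in> off_diag n" for p
    using mem inj by (cases p) (auto simp: off_diag_def pairs_def)
  have bij: "bij (map_prod \<sigma> \<sigma>)"
    using permutes_bij[OF \<sigma>] by (simp add: bij_def map_prod_surj prod.inj_map)
  show "bij_betw (map_prod \<sigma> \<sigma>) {p \<in> off_diag n. Q (map_prod \<sigma> \<sigma> p)} {p \<in> off_diag n. Q p}"
    unfolding bij_betw_def
  proof (intro conjI set_eqI iffI)
    show "inj_on (map_prod \<sigma> \<sigma>) {p \<in> off_diag n. Q (map_prod \<sigma> \<sigma> p)}"
      using bij_is_inj[OF bij] by (rule inj_on_subset) simp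
  next
    fix p assume p: "p \<in> {p \<in> off_diag n. Q p}"
    obtain r where "p = map_prod \<sigma> \<sigma> r" using bij_is_surj[OF bij] by (rule surjE)
    then show "p \<in> map_prod \<sigma> \<sigma> ` {p \<in> off_diag n. Q (map_prod \<sigma> \<sigma> p)}"
      using p off by blast
  next
    fix p assume "p \<in> map_prod \<sigma> \<sigma> ` {p \<in> off_diag n. Q (map_prod \<sigma> \<sigma> p)}"
    then obtain r where "r \<in> off_diag n" "Q (map_prod \<sigma> \<sigma> r)" "p = map_prod \<sigma> \<sigma> r" by auto
    then show "p \<in> {p \<in> off_diag n. Q p}" by (simp only: off mem_Collect_eq simp_thms)
  qed
qed

lemma perm_array_apply:
  "p \<in> pairs n \<Longrightarrow> perm_array n \<sigma> B p = B (map_prod \<sigma> \<sigma> p)"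
  by (cases p) (simp add: perm_array_def)

lemma map_prod_in_pairs:
  "\<sigma> permutes {1..n} \<Longrightarrow> map_prod \<sigma> \<sigma> p \<in> pairs n \<longleftrightarrow> p \<in> pairs n"
  by (cases p) (simp add: pairs_def permutes_in_image del: atLeastAtMost_iff)

text \<open>Relabelling leaves both counts unchanged because it only reindexes the entries counted;
  its sole effect is that the reference score moves from position \<open>q\<close> to its
  image.\<close>

lemma rank_pvalue_perm_array:
  assumes \<sigma>: "\<sigma> permutes {1..n}" and q: "q \<in> off_diag n"
  shows "rank_pvalue (off_diag n) (perm_array n \<sigma> S) (perm_array n \<sigma> m) q =
    rank_pvalue (off_diag n) S m (map_prod \<sigma> \<sigma> q)"
proof -
  have *: "perm_array n \<sigma> B p = B (map_prod \<sigma> \<sigma> p)" if "p \<in> off_diag n" for p and B :: "nat \<times> nat \<Rightarrow> 'c"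
    using that off_diag_subset by (auto intro!: perm_array_apply)
  show ?thesis
    unfolding rank_pvalue_def *[OF q]
    using card_off_diag_perm[OF \<sigma>, of m] card_off_diag_perm[OF \<sigma>, of "\<lambda>p. m p \<and> S (map_prod \<sigma> \<sigma> q) \<le> S p"]
    by (simp add: * cong: conj_cong)
qed

text \<open>The symmetric group acts 2-transitively, so all off-diagonal positions form one orbit.
  This is what makes the events at different positions comparable under joint
  exchangeability.\<close>

lemma ex_permutes_off_diag:
  assumes "p \<in> off_diag n" "q \<in> off_diag n"
  shows "\<exists>\<sigma>. \<sigma> permutes {1..n} \<and> map_prod \<sigma> \<sigma> p = q"
proof -
  obtain k l i j where [simp]: "p = (k, l)" "q = (i, j)" by (cases p, cases q)
  have kl: "k \<in> {1..n}" "l \<in> {1..n}" "k \<noteq> l" and ij: "i \<in> {1..n}" "j \<in> {1..n}" "i \<noteq> j"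
    using assms by (auto simp: off_diag_def pairs_def)
  \<comment> \<open>First \<open>\<tau>\<close> sends \<open>k\<close> to \<open>i\<close>; a second
    transposition then sends \<open>\<tau> l\<close> to \<open>j\<close>. It leaves \<open>i\<close>
    in place because neither \<open>\<tau> l\<close> nor \<open>j\<close> equals
    \<open>i\<close>.\<close>
  define \<tau> where "\<tau> = Transposition.transpose k i"
  have \<tau>: "\<tau> permutes {1..n}" using kl ij unfolding \<tau>_def by (intro permutes_swap_id)
  have \<tau>k: "\<tau> k = i" by (simp add: \<tau>_def)
  then have "\<tau> l \<noteq> i" using kl permutes_inj[OF \<tau>] by (auto dest: injD)
  then have "(Transposition.transpose (\<tau> l) j \<circ> \<tau>) k = i" "(Transposition.transpose (\<tau> l) j \<circ> \<tau>) l = j"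
    using ij \<tau>k by simp_all
  moreover have "(Transposition.transpose (\<tau> l) j \<circ> \<tau>) permutes {1..n}"
    using \<tau> permutes_in_image[OF \<tau>, of l] kl ij by (intro permutes_compose permutes_swap_id) auto
  ultimately show ?thesis by (intro exI[of _ "Transposition.transpose (\<tau> l) j \<circ> \<tau>"]) simp
qed

section \<open>Random arrays: measurability, and the p-value bound under joint
  exchangeability\<close>

lemma measurable_arrays_component:
  "p \<in> pairs n \<Longrightarrow> (\<lambda>B. B p) \<in> arrays n K \<rightarrow>\<^sub>M K"
  unfolding arrays_def by (rule measurable_component_singleton)

lemma measurable_perm_array:
  fixes K :: "'a measure"
  assumes "\<sigma> permutes {1..n}"
  shows "perm_array n \<sigma> \<in> arrays n K \<rightarrow>\<^sub>M arrays n K"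
proof -
  have "(\<lambda>B. \<lambda>p\<in>pairs n. B (map_prod \<sigma> \<sigma> p)) \<in> arrays n K \<rightarrow>\<^sub>M PiM (pairs n) (\<lambda>_. K)"
    using map_prod_in_pairs[OF assms]
    by (intro measurable_restrict measurable_arrays_component) simp
  moreover have "perm_array n \<sigma> = (\<lambda>B. \<lambda>p\<in>pairs n. B (map_prod \<sigma> \<sigma> p) :: 'a)"
    by (auto simp: perm_array_def fun_eq_iff restrict_def)
  ultimately show ?thesis by (simp add: arrays_def)
qed

lemma measurable_card_Collect:
  assumes "finite I" and "\<And>p. p \<in> I \<Longrightarrow> Measurable.pred N (Q p)"
  shows "(\<lambda>x. real (card {p \<in> I. Q p x})) \<in> borel_measurable N"
proof -
  have "real (card {p \<in> I. Q p x}) = (\<Sum>p\<in>I. of_bool (Q p x))" for x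
    using assms(1) by (simp add: of_bool_def sum.If_cases Int_def)
  moreover have "(\<lambda>x. \<Sum>p\<in>I. of_bool (Q p x) :: real) \<in> borel_measurable N"
    using assms(2) by (intro borel_measurable_sum) (simp add: of_bool_def)
  ultimately show ?thesis by simp
qed

lemma measurable_rank_pvalue:
  assumes I: "I \<subseteq> pairs n" and q: "q \<in> pairs n"
  shows "(\<lambda>(S, m). rank_pvalue I S m q) \<in>
    borel_measurable (arrays n borel \<Otimes>\<^sub>M arrays n (count_space UNIV))"
proof -
  let ?N = "arrays n (borel :: ereal measure) \<Otimes>\<^sub>M arrays n (count_space (UNIV :: bool set))"
  have fin: "finite I" using I finite_pairs by (rule finite_subset)
  have S [measurable]: "(\<lambda>x. fst x p) \<in> borel_measurable ?N" if "p \<in> pairs n" for p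
    using measurable_compose[OF measurable_fst measurable_arrays_component[OF that]] .
  have m [measurable]: "(\<lambda>x. snd x p) \<in> ?N \<rightarrow>\<^sub>M count_space UNIV" if "p \<in> pairs n" for p
    using measurable_compose[OF measurable_snd measurable_arrays_component[OF that]] .
  have "(\<lambda>x. real (card {p \<in> I. snd x p})) \<in> borel_measurable ?N"
    using fin I by (intro measurable_card_Collect) auto
  moreover have "(\<lambda>x. real (card {p \<in> I. snd x p \<and> fst x p \<ge> fst x q})) \<in> borel_measurable ?N"
  proof (intro measurable_card_Collect fin)
    fix p assume "p \<in> I"
    then have [measurable]: "p \<in> pairs n" using I by auto
    note q [measurable]
    show "Measurable.pred ?N (\<lambda>x. snd x p \<and> fst x p \<ge> fst x q)" by measurable
  qed
  ultimately show ?thesis unfolding rank_pvalue_def split_beta by measurable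
qed

text \<open>The deterministic counting bound is integrated for an arbitrary jointly exchangeable
  pair of score and sampling arrays. Sampling is kept as part of the event, so conditioning is left
  to a single division at the very end.\<close>

lemma (in prob_space) prob_rank_pvalue_le:
  assumes S: "S \<in> M \<rightarrow>\<^sub>M arrays n borel"
    and A: "A \<in> M \<rightarrow>\<^sub>M arrays n (count_space UNIV)"
    and exch: "\<And>\<sigma>. \<sigma> permutes {1..n} \<Longrightarrow>
        distr M (arrays n borel \<Otimes>\<^sub>M arrays n (count_space UNIV))
          (\<lambda>\<omega>. (perm_array n \<sigma> (S \<omega>), perm_array n \<sigma> (A \<omega>))) =
        distr M (arrays n borel \<Otimes>\<^sub>M arrays n (count_space UNIV)) (\<lambda>\<omega>. (S \<omega>, A \<omega>))"
    and q: "q \<in> off_diag n" and t: "0 \<le> t"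
  shows "\<P>(\<omega> in M. rank_pvalue (off_diag n) (S \<omega>) (A \<omega>) q \<le> t \<and> A \<omega> q)
    \<le> t * \<P>(\<omega> in M. A \<omega> q)"
proof -
  let ?N = "arrays n (borel :: ereal measure) \<Otimes>\<^sub>M arrays n (count_space (UNIV :: bool set))"
  let ?I = "off_diag n"
  \<comment> \<open>\<open>D\<close> is a set of array pairs, so its probability is determined by
    the joint law alone; \<open>F\<close> is the same event in the sample space. The threshold
    \<open>u\<close> stays free because both \<open>u = t\<close> and \<open>u = 1\<close> are used
    below.\<close>
  define D where "D u p = {x \<in> space ?N. rank_pvalue ?I (fst x) (snd x) p \<le> u \<and> snd x p}" for u p
  define F where "F u p = {\<omega> \<in> space M. rank_pvalue ?I (S \<omega>) (A \<omega>) p \<le> u \<and> A \<omega> p}" for u p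
  have SA: "(\<lambda>\<omega>. (S \<omega>, A \<omega>)) \<in> M \<rightarrow>\<^sub>M ?N" using S A by simp
  have D [measurable]: "D u p \<in> sets ?N" if "p \<in> ?I" for u p
  proof -
    have p: "p \<in> pairs n" using that off_diag_subset by auto
    have [measurable]: "(\<lambda>x. rank_pvalue ?I (fst x) (snd x) p) \<in> borel_measurable ?N"
      using measurable_rank_pvalue[OF off_diag_subset p] by (simp add: split_beta)
    have [measurable]: "(\<lambda>x. snd x p) \<in> ?N \<rightarrow>\<^sub>M count_space UNIV"
      using measurable_compose[OF measurable_snd measurable_arrays_component[OF p]] .
    show ?thesis unfolding D_def by measurable
  qed
  have F_eq: "F u p = (\<lambda>\<omega>. (S \<omega>, A \<omega>)) -` D u p \<inter> space M" for u p
    using measurable_space[OF SA] by (auto simp: F_def D_def)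
  have F [measurable]: "F u p \<in> sets M" if "p \<in> ?I" for u p
    unfolding F_eq using SA D[OF that] by (rule measurable_sets)
  have eq: "prob (F u p) = prob (F u q)" if p: "p \<in> ?I" for u p
  proof -
    obtain \<sigma> where \<sigma>: "\<sigma> permutes {1..n}" and \<sigma>q: "map_prod \<sigma> \<sigma> q = p"
      using ex_permutes_off_diag[OF q p] by auto
    let ?g = "\<lambda>\<omega>. (perm_array n \<sigma> (S \<omega>), perm_array n \<sigma> (A \<omega>))"
    have g: "?g \<in> M \<rightarrow>\<^sub>M ?N"
      using measurable_compose[OF S measurable_perm_array[OF \<sigma>]]
        measurable_compose[OF A measurable_perm_array[OF \<sigma>]] by simp
    have "q \<in> pairs n" using q off_diag_subset by auto
    \<comment> \<open>Since \<sigma> carries \<open>q\<close> to \<open>p\<close>, the event at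
      \<open>p\<close> for the original arrays is the event at \<open>q\<close> for the permuted
      arrays, which have the same joint law.\<close>
    then have "F u p = ?g -` D u q \<inter> space M"
      using measurable_space[OF g] rank_pvalue_perm_array[OF \<sigma> q]
      by (auto simp: F_def D_def \<sigma>q perm_array_apply)
    then have "prob (F u p) = measure (distr M ?N ?g) (D u q)"
      using g D[OF q] by (simp add: measure_distr)
    also have "\<dots> = prob (F u q)"
      unfolding exch[OF \<sigma>] F_eq using SA D[OF q] by (simp add: measure_distr)
    finally show ?thesis .
  qed
  have sum: "real (card ?I) * prob (F u q) = expectation (\<lambda>\<omega>. \<Sum>p\<in>?I. indicator (F u p) \<omega>)" for u
  proof -
    have "expectation (\<lambda>\<omega>. \<Sum>p\<in>?I. indicator (F u p) \<omega>) = (\<Sum>p\<in>?I. prob (F u p))"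
      by (subst Bochner_Integration.integral_sum) (auto simp: F integrable_real_indicator emeasure_eq_measure)
    also have "\<dots> = real (card ?I) * prob (F u q)" using eq by simp
    finally show ?thesis by simp
  qed
  have ind: "(\<Sum>p\<in>?I. indicator (F u p) \<omega>) = real (card {p \<in> ?I. A \<omega> p \<and> rank_pvalue ?I (S \<omega>) (A \<omega>) p \<le> u})"
    if "\<omega> \<in> space M" for u \<omega>
    using that by (simp add: indicator_def F_def sum.If_cases Int_def conj_commute)
  have int: "integrable M (\<lambda>\<omega>. \<Sum>p\<in>?I. indicator (F u p) \<omega> :: real)" for u
    by (intro Bochner_Integration.integrable_sum) (auto simp: F integrable_real_indicator emeasure_eq_measure)
  \<comment> \<open>The sum of indicators at threshold 1 counts all sampled off-diagonal entries, so
    the counting bound applies pointwise under the expectation.\<close>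
  have "real (card ?I) * prob (F t q) \<le> expectation (\<lambda>\<omega>. t * (\<Sum>p\<in>?I. indicator (F 1 p) \<omega>))"
    unfolding sum
  proof (intro integral_mono int integrable_mult_right)
    fix \<omega> assume "\<omega> \<in> space M"
    then show "(\<Sum>p\<in>?I. indicator (F t p) \<omega>) \<le> t * (\<Sum>p\<in>?I. indicator (F 1 p) \<omega> :: real)"
      using card_low_rank_pvalue_le[of ?I t "A \<omega>" "S \<omega>"] t by (simp add: ind rank_pvalue_le_1)
  qed
  also have "\<dots> = real (card ?I) * (t * prob (F 1 q))"
    using sum[of 1] by simp
  finally have le: "real (card ?I) * prob (F t q) \<le> real (card ?I) * (t * prob (F 1 q))" .
  \<comment> \<open>The position \<open>q\<close> itself witnesses that the common factor is
    positive and can be cancelled.\<close>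
  have "0 < real (card ?I)" using q unfolding of_nat_0_less_iff card_gt_0_iff by auto
  with le have "prob (F t q) \<le> t * prob (F 1 q)" by (rule mult_left_le_imp_le)
  moreover have "F 1 q = {\<omega> \<in> space M. A \<omega> q}"
    by (auto simp: F_def rank_pvalue_le_1)
  ultimately show ?thesis by (simp add: F_def)
qed

section \<open>Scores as functions of the data: equivariance and measurability\<close>

lemma netcov_array_perm_array:
  assumes "\<sigma> permutes {1..n}"
  shows "netcov_array n (perm_array n \<sigma> v) (perm_array n \<sigma> m) = perm_array n \<sigma> (netcov_array n v m)"
  using map_prod_in_pairs[OF assms]
  by (auto simp: netcov_array_def fun_eq_iff perm_array_apply restrict_def) (auto simp: perm_array_def)

text \<open>The score at a position uses only the response and the fitted value at that position, so
  equivariance of the fitted values carries over entry by entry, including the convention for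
  infinite values.\<close>

lemma scores_perm_array:
  assumes \<sigma>: "\<sigma> permutes {1..n}"
    and fitted: "fitted n \<zeta> mu (perm_array n \<sigma> v) (perm_array n \<sigma> m) = perm_array n \<sigma> (fitted n \<zeta> mu v m)"
  shows "scores n \<zeta> mu s (perm_array n \<sigma> v) (perm_array n \<sigma> m) = perm_array n \<sigma> (scores n \<zeta> mu s v m)"
proof
  fix p
  show "scores n \<zeta> mu s (perm_array n \<sigma> v) (perm_array n \<sigma> m) p = perm_array n \<sigma> (scores n \<zeta> mu s v m) p"
  proof (cases "p \<in> pairs n")
    case True
    then show ?thesis
      using map_prod_in_pairs[OF \<sigma>, of p] by (simp add: scores_def fitted perm_array_apply Let_def)
  next
    \<comment> \<open>Off the index set both sides are \<open>undefined\<close>, as both arrays are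
      extensional.\<close>
    case False
    then show ?thesis by (cases p) (simp add: scores_def perm_array_def)
  qed
qed

lemma measurable_netcov_array:
  "(\<lambda>(v, m). netcov_array n v m) \<in>
    arrays n (obs_space MX ME) \<Otimes>\<^sub>M arrays n (count_space UNIV) \<rightarrow>\<^sub>M arrays n (netcov_space MX ME)"
proof -
  let ?N = "arrays n (obs_space MX ME) \<Otimes>\<^sub>M arrays n (count_space (UNIV :: bool set))"
  have "(\<lambda>x. \<lambda>p\<in>pairs n. case fst x p of (_, y, y', e) \<Rightarrow> (y, y', e, snd x p)) \<in>
      ?N \<rightarrow>\<^sub>M PiM (pairs n) (\<lambda>_. netcov_space MX ME)"
  proof (rule measurable_restrict)
    fix p assume p: "p \<in> pairs n"
    have [measurable]: "(\<lambda>x. fst x p) \<in> ?N \<rightarrow>\<^sub>M borel \<Otimes>\<^sub>M MX \<Otimes>\<^sub>M MX \<Otimes>\<^sub>M ME"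
      using measurable_compose[OF measurable_fst measurable_arrays_component[OF p]]
      by (simp add: obs_space_def)
    have [measurable]: "(\<lambda>x. snd x p) \<in> ?N \<rightarrow>\<^sub>M count_space UNIV"
      using measurable_compose[OF measurable_snd measurable_arrays_component[OF p]] .
    show "(\<lambda>x. case fst x p of (_, y, y', e) \<Rightarrow> (y, y', e, snd x p)) \<in> ?N \<rightarrow>\<^sub>M netcov_space MX ME"
      unfolding netcov_space_def split_beta by measurable
  qed
  then show ?thesis by (simp add: netcov_array_def arrays_def split_beta)
qed

text \<open>Only finitely many index sets are possible, so it suffices to check the fibre over each
  one, and a fibre is a finite conjunction of conditions on single entries of the sampling
  matrix.\<close>

lemma measurable_sampled_set:
  "(\<lambda>(v, m). {p \<in> pairs n. m p}) \<in>
    N \<Otimes>\<^sub>M arrays n (count_space UNIV) \<rightarrow>\<^sub>M count_space (Pow (pairs n))"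
proof (subst measurable_count_space_eq_countable, goal_cases)
  case 1
  then show ?case by (simp add: countable_finite)
next
  case 2
  let ?N = "N \<Otimes>\<^sub>M arrays n (count_space (UNIV :: bool set))"
  have "(\<lambda>(v, m). {p \<in> pairs n. m p}) -` {H} \<inter> space ?N \<in> sets ?N" if H: "H \<subseteq> pairs n" for H
  proof -
    have "{p \<in> pairs n. m p} = H \<longleftrightarrow> (\<forall>p\<in>pairs n. m p \<longleftrightarrow> p \<in> H)" for m
      using H by blast
    then have "(\<lambda>(v, m). {p \<in> pairs n. m p}) -` {H} \<inter> space ?N =
        {x \<in> space ?N. \<forall>p\<in>pairs n. snd x p \<longleftrightarrow> p \<in> H}"
      by (simp only: vimage_def split_beta Int_def conj_commute mem_Collect_eq singleton_iff)
    also have "\<dots> \<in> sets ?N"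
    proof (intro sets.sets_Collect_finite_All finite_pairs)
      fix p assume p: "p \<in> pairs n"
      have [measurable]: "(\<lambda>x. snd x p) \<in> ?N \<rightarrow>\<^sub>M count_space UNIV"
        using measurable_compose[OF measurable_snd measurable_arrays_component[OF p]] .
      show "{x \<in> space ?N. snd x p \<longleftrightarrow> p \<in> H} \<in> sets ?N" by measurable
    qed
    finally show ?thesis .
  qed
  then show ?case by auto
qed

text \<open>Training families over different index sets live in different product spaces, so
  measurability of \<open>mu\<close> is stated for each fixed index set. The sampled set is random
  but takes finitely many values, and the fixed-set statements are glued along it.\<close>

lemma measurable_fitted:
  fixes \<zeta> :: "(nat \<times> nat \<Rightarrow> ('x, 'e) netcov) \<Rightarrow> nat \<times> nat \<Rightarrow> ('u, 'w) netsum"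
  assumes zeta: "\<zeta> \<in> arrays n (netcov_space MX ME) \<rightarrow>\<^sub>M arrays n (netsum_space MU MW)"
    and mu: "\<And>H. H \<subseteq> pairs n \<Longrightarrow>
        (\<lambda>(x, f). mu x (H, f)) \<in> borel_measurable
          (info_space MX ME MU MW \<Otimes>\<^sub>M PiM H (\<lambda>_. obs_space MX ME \<Otimes>\<^sub>M netsum_space MU MW))"
    and p: "p \<in> pairs n"
  shows "(\<lambda>(v, m). fitted n \<zeta> mu v m p) \<in>
    borel_measurable (arrays n (obs_space MX ME) \<Otimes>\<^sub>M arrays n (count_space UNIV))"
proof -
  let ?N = "arrays n (obs_space MX ME) \<Otimes>\<^sub>M arrays n (count_space (UNIV :: bool set))"
  define x where "x = (\<lambda>(v, m). netcov_array n v m :: nat \<times> nat \<Rightarrow> ('x, 'e) netcov)"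
  define z where "z w = \<zeta> (x w)" for w
  define H :: "(nat \<times> nat \<Rightarrow> ('x, 'e) obs) \<times> (nat \<times> nat \<Rightarrow> bool) \<Rightarrow> (nat \<times> nat) set"
    where "H = (\<lambda>(v, m). {p \<in> pairs n. m p})"
  have x: "x \<in> ?N \<rightarrow>\<^sub>M arrays n (netcov_space MX ME)"
    unfolding x_def by (rule measurable_netcov_array)
  have z: "z \<in> ?N \<rightarrow>\<^sub>M arrays n (netsum_space MU MW)"
    unfolding z_def using measurable_compose[OF x zeta] .
  have info: "(\<lambda>w. (x w p, z w p, snd w p)) \<in> ?N \<rightarrow>\<^sub>M info_space MX ME MU MW"
    unfolding info_space_def
    using measurable_compose[OF x measurable_arrays_component[OF p]]
      measurable_compose[OF z measurable_arrays_component[OF p]]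
      measurable_compose[OF measurable_snd measurable_arrays_component[OF p]]
    by (intro measurable_Pair)
  \<comment> \<open>Here the index set of the training family is frozen at \<open>K\<close>, while
    covariates, summaries and sampling indicator still vary with the data.\<close>
  have fixed: "(\<lambda>w. mu (x w p, z w p, snd w p) (K, \<lambda>r\<in>K. (fst w r, z w r))) \<in> borel_measurable ?N"
    if "K \<in> Pow (pairs n)" for K
  proof -
    have "(\<lambda>w. \<lambda>r\<in>K. (fst w r, z w r)) \<in> ?N \<rightarrow>\<^sub>M PiM K (\<lambda>_. obs_space MX ME \<Otimes>\<^sub>M netsum_space MU MW)"
    proof (intro measurable_restrict measurable_Pair)
      fix r assume "r \<in> K"
      then have r: "r \<in> pairs n" using that by auto
      show "(\<lambda>w. fst w r) \<in> ?N \<rightarrow>\<^sub>M obs_space MX ME"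
        using measurable_compose[OF measurable_fst measurable_arrays_component[OF r]] .
      show "(\<lambda>w. z w r) \<in> ?N \<rightarrow>\<^sub>M netsum_space MU MW"
        using measurable_compose[OF z measurable_arrays_component[OF r]] .
    qed
    from measurable_compose[OF measurable_Pair[OF info this] mu] that show ?thesis by simp
  qed
  have "H \<in> ?N \<rightarrow>\<^sub>M count_space (Pow (pairs n))"
    unfolding H_def by (rule measurable_sampled_set)
  \<comment> \<open>Substituting the random set \<open>H w\<close> for \<open>K\<close> preserves
    measurability, because \<open>H\<close> ranges over a countable space.\<close>
  from measurable_compose_countable'[OF fixed this]
  have "(\<lambda>w. mu (x w p, z w p, snd w p) (H w, \<lambda>r\<in>H w. (fst w r, z w r))) \<in> borel_measurable ?N"
    by (simp add: countable_finite)
  then show ?thesis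
    using p by (simp add: fitted_def predictions_def info_array_def training_set_def Let_def
        x_def z_def H_def split_beta)
qed

lemma measurable_scores:
  assumes zeta: "\<zeta> \<in> arrays n (netcov_space MX ME) \<rightarrow>\<^sub>M arrays n (netsum_space MU MW)"
    and mu: "\<And>H. H \<subseteq> pairs n \<Longrightarrow>
        (\<lambda>(x, f). mu x (H, f)) \<in> borel_measurable
          (info_space MX ME MU MW \<Otimes>\<^sub>M PiM H (\<lambda>_. obs_space MX ME \<Otimes>\<^sub>M netsum_space MU MW))"
    and s: "(\<lambda>(y, f). s y f) \<in> borel_measurable (borel \<Otimes>\<^sub>M borel)"
  shows "(\<lambda>(v, m). scores n \<zeta> mu s v m) \<in>
    arrays n (obs_space MX ME) \<Otimes>\<^sub>M arrays n (count_space UNIV) \<rightarrow>\<^sub>M arrays n borel"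
proof -
  let ?N = "arrays n (obs_space MX ME) \<Otimes>\<^sub>M arrays n (count_space (UNIV :: bool set))"
  have "(\<lambda>w. \<lambda>p\<in>pairs n. let f = fitted n \<zeta> mu (fst w) (snd w) p
        in if \<bar>f\<bar> = \<infinity> then \<infinity> else ereal (s (fst (fst w p)) (real_of_ereal f)))
      \<in> ?N \<rightarrow>\<^sub>M PiM (pairs n) (\<lambda>_. borel)"
  proof (rule measurable_restrict)
    fix p assume p: "p \<in> pairs n"
    have f [measurable]: "(\<lambda>w. fitted n \<zeta> mu (fst w) (snd w) p) \<in> borel_measurable ?N"
      using measurable_fitted[OF zeta mu p] by (simp add: split_beta)
    have "(\<lambda>w. fst w p) \<in> ?N \<rightarrow>\<^sub>M borel \<Otimes>\<^sub>M MX \<Otimes>\<^sub>M MX \<Otimes>\<^sub>M ME"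
      using measurable_compose[OF measurable_fst measurable_arrays_component[OF p]]
      by (simp add: obs_space_def)
    from measurable_compose[OF this measurable_fst]
    have [measurable]: "(\<lambda>w. fst (fst w p)) \<in> borel_measurable ?N" .
    \<comment> \<open>\<open>real_of_ereal\<close> is total, so the finite branch is measurable on
      the whole space before the two cases are joined.\<close>
    have "(\<lambda>w. (fst (fst w p), real_of_ereal (fitted n \<zeta> mu (fst w) (snd w) p)))
        \<in> ?N \<rightarrow>\<^sub>M borel \<Otimes>\<^sub>M borel"
      by measurable
    from measurable_compose[OF this s]
    have [measurable]: "(\<lambda>w. s (fst (fst w p)) (real_of_ereal (fitted n \<zeta> mu (fst w) (snd w) p)))
        \<in> borel_measurable ?N"
      by simp
    show "(\<lambda>w. let f = fitted n \<zeta> mu (fst w) (snd w) p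
        in if \<bar>f\<bar> = \<infinity> then \<infinity> else ereal (s (fst (fst w p)) (real_of_ereal f))) \<in> borel_measurable ?N"
      unfolding Let_def by measurable
  qed
  then show ?thesis by (simp add: scores_def arrays_def split_beta)
qed

section \<open>Observed arrays, candidate responses and the final theorem\<close>

lemma measurable_obs_array:
  assumes "\<And>p. p \<in> pairs n \<Longrightarrow> Y p \<in> borel_measurable P"
    and "\<And>i. i \<in> {1..n} \<Longrightarrow> X i \<in> P \<rightarrow>\<^sub>M MX"
    and "\<And>p. p \<in> pairs n \<Longrightarrow> E p \<in> P \<rightarrow>\<^sub>M ME"
  shows "obs_array n Y X E \<in> P \<rightarrow>\<^sub>M arrays n (obs_space MX ME)"
proof -
  have "(\<lambda>\<omega>. \<lambda>p\<in>pairs n. (Y p \<omega>, X (fst p) \<omega>, X (snd p) \<omega>, E p \<omega>))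
      \<in> P \<rightarrow>\<^sub>M PiM (pairs n) (\<lambda>_. borel \<Otimes>\<^sub>M MX \<Otimes>\<^sub>M MX \<Otimes>\<^sub>M ME)"
    using assms by (intro measurable_restrict measurable_Pair) (auto simp: pairs_def)
  moreover have "obs_array n Y X E = (\<lambda>\<omega>. \<lambda>p\<in>pairs n. (Y p \<omega>, X (fst p) \<omega>, X (snd p) \<omega>, E p \<omega>))"
    by (auto simp: obs_array_def fun_eq_iff restrict_def)
  ultimately show ?thesis by (simp add: arrays_def obs_space_def)
qed

lemma measurable_sample_array:
  assumes "\<And>p. p \<in> pairs n \<Longrightarrow> M p \<in> P \<rightarrow>\<^sub>M count_space UNIV"
  shows "sample_array n M \<in> P \<rightarrow>\<^sub>M arrays n (count_space UNIV)"
  unfolding sample_array_def arrays_def using assms by (intro measurable_restrict)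

text \<open>Each overwritten entry agrees with the response of the test pair throughout the sample
  space, so inserting the true response changes nothing. Hence refitting at the true value
  reproduces the original fit, whether or not the mirrored entry is overwritten too.\<close>

lemma set_response_obs_array:
  assumes "\<omega> \<in> space P" and "(k, l) \<in> pairs n" and "(l, k) \<in> pairs n"
  shows "set_response (test_entries P Y k l) (Y (k, l) \<omega>) (obs_array n Y X E \<omega>) = obs_array n Y X E \<omega>"
  using assms by (auto simp: set_response_def test_entries_def obs_array_def fun_eq_iff)

lemma mem_conf_set_obs_array:
  assumes "\<omega> \<in> space P" and "(k, l) \<in> pairs n" and "(l, k) \<in> pairs n"
  shows "Y (k, l) \<omega> \<in> conf_set n \<zeta> mu s \<alpha> (test_entries P Y k l) (obs_array n Y X E \<omega>) m q \<longleftrightarrow>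
    \<not> conf_pvalue n \<zeta> mu s (obs_array n Y X E \<omega>) m q \<le> \<alpha>"
  by (simp add: conf_set_def set_response_obs_array[OF assms] not_le)

theorem theorem4p1:
  fixes P :: "'o measure" and n :: nat
    and MX :: "'x measure" and ME :: "'e measure" and MU :: "'u measure" and MW :: "'w measure"
    and Y :: "nat \<times> nat \<Rightarrow> 'o \<Rightarrow> real"
    and X :: "nat \<Rightarrow> 'o \<Rightarrow> 'x"
    and E :: "nat \<times> nat \<Rightarrow> 'o \<Rightarrow> 'e"
    and M :: "nat \<times> nat \<Rightarrow> 'o \<Rightarrow> bool"
    and \<zeta> :: "(nat \<times> nat \<Rightarrow> ('x, 'e) netcov) \<Rightarrow> nat \<times> nat \<Rightarrow> ('u, 'w) netsum"
    and mu :: "('x, 'e, 'u, 'w) info \<Rightarrow> ('x, 'e, 'u, 'w) training \<Rightarrow> ereal"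
    and s :: "real \<Rightarrow> real \<Rightarrow> real"
  defines "V \<equiv> obs_array n Y X E"
    and "A \<equiv> sample_array n M"
  assumes prob: "prob_space P"
    and Y_meas: "\<And>p. p \<in> pairs n \<Longrightarrow> Y p \<in> borel_measurable P"
    and X_meas: "\<And>i. i \<in> {1..n} \<Longrightarrow> X i \<in> P \<rightarrow>\<^sub>M MX"
    and E_meas: "\<And>p. p \<in> pairs n \<Longrightarrow> E p \<in> P \<rightarrow>\<^sub>M ME"
    and M_meas: "\<And>p. p \<in> pairs n \<Longrightarrow> M p \<in> P \<rightarrow>\<^sub>M count_space UNIV"
    and zeta_meas: "\<zeta> \<in> arrays n (netcov_space MX ME) \<rightarrow>\<^sub>M arrays n (netsum_space MU MW)"
    and zeta_form: "\<And>x. x \<in> space (arrays n (netcov_space MX ME)) \<Longrightarrow> node_pair_array n (\<zeta> x)"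
    and mu_meas: "\<And>H. H \<subseteq> pairs n \<Longrightarrow>
        (\<lambda>(x, f). mu x (H, f)) \<in> borel_measurable
          (info_space MX ME MU MW \<Otimes>\<^sub>M PiM H (\<lambda>_. obs_space MX ME \<Otimes>\<^sub>M netsum_space MU MW))"
    and mu_range: "\<And>\<omega> p. \<omega> \<in> space P \<Longrightarrow> p \<in> pairs n \<Longrightarrow>
        fitted n \<zeta> mu (V \<omega>) (A \<omega>) p \<noteq> - \<infinity> \<and>
        (M p \<omega> \<longrightarrow> fitted n \<zeta> mu (V \<omega>) (A \<omega>) p \<noteq> \<infinity>)"
    and s_meas: "(\<lambda>(y, f). s y f) \<in> borel_measurable (borel \<Otimes>\<^sub>M borel)"
    and M_sym: "AE \<omega> in P. \<forall>i\<in>{1..n}. \<forall>j\<in>{1..n}. M (i, j) \<omega> = M (j, i) \<omega>"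
    and exchangeable: "\<And>\<sigma>. \<sigma> permutes {1..n} \<Longrightarrow>
        distr P (arrays n (obs_space MX ME) \<Otimes>\<^sub>M arrays n (count_space UNIV))
          (\<lambda>\<omega>. (perm_array n \<sigma> (V \<omega>), perm_array n \<sigma> (A \<omega>))) =
        distr P (arrays n (obs_space MX ME) \<Otimes>\<^sub>M arrays n (count_space UNIV))
          (\<lambda>\<omega>. (V \<omega>, A \<omega>))"
    and network_covariates: "\<And>\<sigma>. \<sigma> permutes {1..n} \<Longrightarrow>
        AE \<omega> in P. perm_array n \<sigma> (\<zeta> (netcov_array n (V \<omega>) (A \<omega>))) =
          \<zeta> (perm_array n \<sigma> (netcov_array n (V \<omega>) (A \<omega>)))"
    and invariant_model: "\<And>\<sigma>. \<sigma> permutes {1..n} \<Longrightarrow>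
        AE \<omega> in P.
          (let x = netcov_array n (V \<omega>) (A \<omega>); z = \<zeta> x in
           perm_array n \<sigma> (fitted n \<zeta> mu (V \<omega>) (A \<omega>)) =
           predictions n mu
             (info_array n (perm_array n \<sigma> x) (perm_array n \<sigma> z) (perm_array n \<sigma> (A \<omega>)))
             (training_set n (perm_array n \<sigma> (V \<omega>)) (perm_array n \<sigma> z) (perm_array n \<sigma> (A \<omega>))))"
    and scores_sym: "AE \<omega> in P. \<forall>i\<in>{1..n}. \<forall>j\<in>{1..n}.
        scores n \<zeta> mu s (V \<omega>) (A \<omega>) (i, j) = scores n \<zeta> mu s (V \<omega>) (A \<omega>) (j, i)"
  shows "\<forall>k l. 1 \<le> k \<and> k < l \<and> l \<le> n \<and> \<P>(\<omega> in P. M (k, l) \<omega>) > 0 \<longrightarrow>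
      (\<forall>t\<in>{0..1}.
        \<P>(\<omega> in P. conf_pvalue n \<zeta> mu s (V \<omega>) (A \<omega>) (k, l) \<le> t \<bar> M (k, l) \<omega>) \<le> t) \<and>
      (\<forall>\<alpha>\<in>{0..1}.
        \<P>(\<omega> in P. Y (k, l) \<omega> \<in> conf_set n \<zeta> mu s \<alpha> (test_entries P Y k l) (V \<omega>) (A \<omega>) (k, l)
             \<bar> M (k, l) \<omega>) \<ge> 1 - \<alpha>)"
proof (intro allI impI)
  interpret prob_space P by (rule prob)
  let ?NV = "arrays n (obs_space MX ME) \<Otimes>\<^sub>M arrays n (count_space (UNIV :: bool set))"
  let ?NS = "arrays n (borel :: ereal measure) \<Otimes>\<^sub>M arrays n (count_space (UNIV :: bool set))"
  define S where "S \<omega> = scores n \<zeta> mu s (V \<omega>) (A \<omega>)" for \<omega>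
  have V: "V \<in> P \<rightarrow>\<^sub>M arrays n (obs_space MX ME)"
    unfolding V_def using Y_meas X_meas E_meas by (rule measurable_obs_array)
  have A: "A \<in> P \<rightarrow>\<^sub>M arrays n (count_space UNIV)"
    unfolding A_def using M_meas by (rule measurable_sample_array)
  have VA: "(\<lambda>\<omega>. (V \<omega>, A \<omega>)) \<in> P \<rightarrow>\<^sub>M ?NV" using V A by simp
  have scores: "(\<lambda>(v, m). scores n \<zeta> mu s v m) \<in> ?NV \<rightarrow>\<^sub>M arrays n borel"
    using zeta_meas mu_meas s_meas by (rule measurable_scores)
  \<comment> \<open>The map \<open>g\<close> turns data into scores while retaining the sampling
    matrix; the joint law of \<open>S\<close> and \<open>A\<close> is the image of the data law
    under it.\<close>
  define g where "g w = (scores n \<zeta> mu s (fst w) (snd w), snd w)" for w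
  have g: "g \<in> ?NV \<rightarrow>\<^sub>M ?NS"
    using scores unfolding g_def by (simp add: split_beta)
  have S: "S \<in> P \<rightarrow>\<^sub>M arrays n borel"
    unfolding S_def using measurable_compose[OF VA scores] by simp
  have exch: "distr P ?NS (\<lambda>\<omega>. (perm_array n \<sigma> (S \<omega>), perm_array n \<sigma> (A \<omega>))) =
      distr P ?NS (\<lambda>\<omega>. (S \<omega>, A \<omega>))" if \<sigma>: "\<sigma> permutes {1..n}" for \<sigma>
  proof -
    note perm = measurable_perm_array[OF \<sigma>]
    have VA\<sigma>: "(\<lambda>\<omega>. (perm_array n \<sigma> (V \<omega>), perm_array n \<sigma> (A \<omega>))) \<in> P \<rightarrow>\<^sub>M ?NV"
      using measurable_compose[OF V perm] measurable_compose[OF A perm] by simp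
    have SA\<sigma>: "(\<lambda>\<omega>. (perm_array n \<sigma> (S \<omega>), perm_array n \<sigma> (A \<omega>))) \<in> P \<rightarrow>\<^sub>M ?NS"
      using measurable_compose[OF S perm] measurable_compose[OF A perm] by simp
    \<comment> \<open>Permuting the scores agrees almost surely with recomputing them from permuted
      data. The invariant model describes a fit with permuted summaries, and the network covariate
      condition identifies these with the summaries recomputed from permuted covariates.\<close>
    have "AE \<omega> in P. (perm_array n \<sigma> (S \<omega>), perm_array n \<sigma> (A \<omega>)) =
        g (perm_array n \<sigma> (V \<omega>), perm_array n \<sigma> (A \<omega>))"
      using network_covariates[OF \<sigma>] invariant_model[OF \<sigma>]
    proof eventually_elim
      case (elim \<omega>)
      have "fitted n \<zeta> mu (perm_array n \<sigma> (V \<omega>)) (perm_array n \<sigma> (A \<omega>)) =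
          perm_array n \<sigma> (fitted n \<zeta> mu (V \<omega>) (A \<omega>))"
        using elim unfolding fitted_def[of n \<zeta> mu "perm_array n \<sigma> (V \<omega>)"]
        by (simp add: Let_def netcov_array_perm_array[OF \<sigma>])
      from scores_perm_array[OF \<sigma> this] show ?case by (simp add: g_def S_def)
    qed
    then have "distr P ?NS (\<lambda>\<omega>. (perm_array n \<sigma> (S \<omega>), perm_array n \<sigma> (A \<omega>))) =
        distr P ?NS (\<lambda>\<omega>. g (perm_array n \<sigma> (V \<omega>), perm_array n \<sigma> (A \<omega>)))"
      using SA\<sigma> measurable_compose[OF VA\<sigma> g] by (intro distr_cong_AE) auto
    \<comment> \<open>Both laws are now images under the same map \<open>g\<close>, so
      exchangeability of the data transfers to the scores.\<close>
    also have "\<dots> = distr (distr P ?NV (\<lambda>\<omega>. (perm_array n \<sigma> (V \<omega>), perm_array n \<sigma> (A \<omega>)))) ?NS g"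
      using distr_distr[OF g VA\<sigma>] by (simp add: comp_def)
    also have "\<dots> = distr P ?NS (\<lambda>\<omega>. g (V \<omega>, A \<omega>))"
      unfolding exchangeable[OF \<sigma>] using distr_distr[OF g VA] by (simp add: comp_def)
    finally show ?thesis by (simp add: g_def S_def)
  qed
  fix k l
  assume kl: "1 \<le> k \<and> k < l \<and> l \<le> n \<and> \<P>(\<omega> in P. M (k, l) \<omega>) > 0"
  let ?q = "(k, l)"
  let ?pv = "\<lambda>\<omega>. conf_pvalue n \<zeta> mu s (V \<omega>) (A \<omega>) ?q"
  have q: "?q \<in> off_diag n" "?q \<in> pairs n" "(l, k) \<in> pairs n"
    using kl by (auto simp: off_diag_def pairs_def)
  have AM: "A \<omega> ?q = M ?q \<omega>" for \<omega> using q by (simp add: A_def sample_array_def)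
  have SA: "(\<lambda>\<omega>. (S \<omega>, A \<omega>)) \<in> P \<rightarrow>\<^sub>M ?NS" using S A by simp
  have pv_eq: "?pv \<omega> = rank_pvalue (upper_pairs n) (S \<omega>) (A \<omega>) ?q" for \<omega>
    by (simp add: conf_pvalue_eq_rank_pvalue S_def)
  have pv [measurable]: "?pv \<in> borel_measurable P"
    unfolding pv_eq using measurable_compose[OF SA measurable_rank_pvalue[OF upper_pairs_subset q(2)]]
    by simp
  have rk [measurable]: "(\<lambda>\<omega>. rank_pvalue (off_diag n) (S \<omega>) (A \<omega>) ?q) \<in> borel_measurable P"
    using measurable_compose[OF SA measurable_rank_pvalue[OF off_diag_subset q(2)]] by simp
  note M_meas[OF q(2), measurable]
  \<comment> \<open>Symmetry of the sampling matrix and of the scores holds only almost surely, so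
    the change of index set is an almost sure identity, which is enough for probabilities.\<close>
  have pv_off: "AE \<omega> in P. ?pv \<omega> = rank_pvalue (off_diag n) (S \<omega>) (A \<omega>) ?q"
    using M_sym scores_sym
  proof eventually_elim
    case (elim \<omega>)
    show ?case unfolding pv_eq
    proof (rule rank_pvalue_symmetric)
      fix i j assume "(i, j) \<in> off_diag n"
      then have ij: "i \<in> {1..n}" "j \<in> {1..n}" by (auto simp: off_diag_def pairs_def)
      then show "S \<omega> (i, j) = S \<omega> (j, i)" using elim(2) by (simp add: S_def)
      show "A \<omega> (i, j) = A \<omega> (j, i)"
        using elim(1) ij by (simp add: A_def sample_array_def pairs_def)
    qed
  qed
  have joint: "\<P>(\<omega> in P. ?pv \<omega> \<le> t \<and> M ?q \<omega>) \<le> t * \<P>(\<omega> in P. M ?q \<omega>)" if "0 \<le> t" for t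
  proof -
    have "\<P>(\<omega> in P. ?pv \<omega> \<le> t \<and> M ?q \<omega>) =
        \<P>(\<omega> in P. rank_pvalue (off_diag n) (S \<omega>) (A \<omega>) ?q \<le> t \<and> M ?q \<omega>)"
    proof (rule prob_eq_AE)
      show "AE \<omega> in P. (?pv \<omega> \<le> t \<and> M ?q \<omega>) \<longleftrightarrow>
          (rank_pvalue (off_diag n) (S \<omega>) (A \<omega>) ?q \<le> t \<and> M ?q \<omega>)"
        using pv_off by eventually_elim simp
    qed measurable
    also have "\<dots> \<le> t * \<P>(\<omega> in P. M ?q \<omega>)"
      using prob_rank_pvalue_le[OF S A exch q(1) that] by (simp add: AM)
    finally show ?thesis .
  qed
  \<comment> \<open>Positive probability of sampling the test pair allows division of the joint
    bound.\<close>
  have valid: "\<P>(\<omega> in P. ?pv \<omega> \<le> t \<bar> M ?q \<omega>) \<le> t" if "0 \<le> t" for t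
    using joint[OF that] kl by (simp add: cond_prob_def divide_le_eq)
  moreover have "\<P>(\<omega> in P. Y ?q \<omega> \<in> conf_set n \<zeta> mu s \<alpha> (test_entries P Y k l) (V \<omega>) (A \<omega>) ?q
      \<bar> M ?q \<omega>) = 1 - \<P>(\<omega> in P. ?pv \<omega> \<le> \<alpha> \<bar> M ?q \<omega>)" for \<alpha>
  proof -
    \<comment> \<open>Within the event that the pair is sampled, coverage is exactly the complement
      of a p-value at most \<alpha>, because the candidate is the true response.\<close>
    have "{\<omega> \<in> space P. Y ?q \<omega> \<in> conf_set n \<zeta> mu s \<alpha> (test_entries P Y k l) (V \<omega>) (A \<omega>) ?q \<and> M ?q \<omega>} =
        {\<omega> \<in> space P. M ?q \<omega>} - {\<omega> \<in> space P. ?pv \<omega> \<le> \<alpha> \<and> M ?q \<omega>}"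
      unfolding V_def by (auto simp: mem_conf_set_obs_array[OF _ q(2,3)])
    moreover have "prob ({\<omega> \<in> space P. M ?q \<omega>} - {\<omega> \<in> space P. ?pv \<omega> \<le> \<alpha> \<and> M ?q \<omega>}) =
        \<P>(\<omega> in P. M ?q \<omega>) - \<P>(\<omega> in P. ?pv \<omega> \<le> \<alpha> \<and> M ?q \<omega>)"
      by (intro finite_measure_Diff) (measurable, auto)
    ultimately show ?thesis using kl by (simp add: cond_prob_def diff_divide_distrib)
  qed
  ultimately show "(\<forall>t\<in>{0..1}. \<P>(\<omega> in P. ?pv \<omega> \<le> t \<bar> M ?q \<omega>) \<le> t) \<and>
      (\<forall>\<alpha>\<in>{0..1}.
        \<P>(\<omega> in P. Y ?q \<omega> \<in> conf_set n \<zeta> mu s \<alpha> (test_entries P Y k l) (V \<omega>) (A \<omega>) ?q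
             \<bar> M ?q \<omega>) \<ge> 1 - \<alpha>)"
    by simp
qed

end
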